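(* Let $\Omega=D(0,1)\subset\mathbb{R}^2$ be the open unit disc and let $B:\Omega\to\mathbb{R}$ be a locally Lipschitz radial magnetic field (i.e. $B(q)$ depends only on $\|q\|$). Let $q(t)=(q_1(t),q_2(t))$ be a solution of the magnetic equations of motion with field $B$ starting at $t=0$ from inside the unit disc. Assume that the initial data $(q(0),\dot q(0))$ satisfy at least one of the following two hypotheses: (H1) $$\liminf_{r\to1^-}\left|\frac{1}{2\pi}\int_{\|q(0)\|\le\|q\|\le r}B(q)\,\mathrm{d}q-\det(q(0),\dot q(0))\right|>\|\dot q(0)\|;$$ (H2) $$\liminf_{r\to1^-}\left|\frac{1}{2\pi}\int_{\|q(0)\|\le\|q\|\le r}B(q)\,\mathrm{d}q-\det(q(0),\dot q(0))\right|=\|\dot q(0)\|$$ and $$\limsup_{r\to1^-}\frac{\left|\frac{1}{2\pi}\int_{\|q(0)\|\le\|q\|\le r}B(q)\,\mathrm{d}q-\det(q(0),\dot q(0))\right|-\|\dot q(0)\|}{r-1}<0.$$ Then the solution exists for all $t\ge0$, and there exists $\eta\in[0,1)$ such that $\|q(t)\|<\eta$ for all $t\ge0$.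
   Context: The particle has unit charge and mass and moves in the disc according to Newton's equation $\ddot q=B(q)\,(\dot q_2,-\dot q_1)$, where $q=(q_1,q_2)$. Equivalently, it follows the Hamiltonian flow of $\mathcal{H}(q,p)=\frac12\|p-\mathbf{A}(q)\|^2$ with $p=\dot q+\mathbf{A}(q)$, where $\mathbf{A}$ is a vector potential satisfying $\partial_{q_1}A_2-\partial_{q_2}A_1=B$. The norm $\|\cdot\|$ is the Euclidean norm, $\det(u,v)=u_1v_2-u_2v_1$, and $\mathrm{d}q$ is Lebesgue measure on $\mathbb{R}^2$. *)

theory Defs
  imports "HOL-Analysis.Analysis"
begin

abbreviation unit_disc :: "(real^2) set" where
  "unit_disc \<equiv> ball 0 1"

definition radial_on :: "(real^2) set \<Rightarrow> (real^2 \<Rightarrow> real) \<Rightarrow> bool" where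
  "radial_on S B \<longleftrightarrow> (\<forall>x\<in>S. \<forall>y\<in>S. norm x = norm y \<longrightarrow> B x = B y)"

definition pdet :: "real^2 \<Rightarrow> real^2 \<Rightarrow> real" where
  "pdet u v = u $ 1 * v $ 2 - u $ 2 * v $ 1"

definition time_dom :: "ereal \<Rightarrow> real set" where
  "time_dom T = {t. 0 \<le> t \<and> ereal t < T}"

text \<open>
  Solutions of Newton's equation in the disc, written as a first-order system for the
  position q and the velocity v. The lifespan T is positive and may be infinite; the derivative
  at time 0 is one-sided. Values of q and v outside \<^term>\<open>time_dom T\<close> are irrelevant.
\<close>
definition magnetic_solution ::
    "(real^2 \<Rightarrow> real) \<Rightarrow> ereal \<Rightarrow> (real \<Rightarrow> real^2) \<Rightarrow> (real \<Rightarrow> real^2) \<Rightarrow> bool" where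
  "magnetic_solution B T q v \<longleftrightarrow> 0 < T \<and>
     (\<forall>t\<in>time_dom T. q t \<in> unit_disc \<and>
        (q has_vector_derivative v t) (at t within time_dom T) \<and>
        (v has_vector_derivative B (q t) *\<^sub>R vector [v t $ 2, - (v t $ 1)])
          (at t within time_dom T))"

text \<open>
  Forward-maximal solutions: a solution on \<^term>\<open>time_dom T\<close> that is not the restriction
  of a solution with a longer lifespan. Agreement of the positions on
  \<^term>\<open>time_dom T\<close> forces agreement of the velocities there.
\<close>
definition maximal_magnetic_solution ::
    "(real^2 \<Rightarrow> real) \<Rightarrow> ereal \<Rightarrow> (real \<Rightarrow> real^2) \<Rightarrow> (real \<Rightarrow> real^2) \<Rightarrow> bool" where
  "maximal_magnetic_solution B T q v \<longleftrightarrow> magnetic_solution B T q v \<and>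
     \<not> (\<exists>T' q' v'. T < T' \<and> magnetic_solution B T' q' v' \<and> (\<forall>t\<in>time_dom T. q' t = q t))"

text \<open>
  The quantity inside the absolute values of the two hypotheses, for initial position
  \<open>x\<close> and initial velocity \<open>w\<close>.
\<close>
definition flux_defect :: "(real^2 \<Rightarrow> real) \<Rightarrow> real^2 \<Rightarrow> real^2 \<Rightarrow> real \<Rightarrow> real" where
  "flux_defect B x w r =
     1 / (2 * pi) * (LINT y:{y. norm x \<le> norm y \<and> norm y \<le> r}|lborel. B y) - pdet x w"

text \<open>
  Lower and upper limits are taken in the extended reals, since the flux may diverge as
  r tends to 1.
\<close>
definition hyp_H1 :: "(real^2 \<Rightarrow> real) \<Rightarrow> real^2 \<Rightarrow> real^2 \<Rightarrow> bool" where
  "hyp_H1 B x w \<longleftrightarrow>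
     Liminf (at_left 1) (\<lambda>r. ereal \<bar>flux_defect B x w r\<bar>) > ereal (norm w)"

definition hyp_H2 :: "(real^2 \<Rightarrow> real) \<Rightarrow> real^2 \<Rightarrow> real^2 \<Rightarrow> bool" where
  "hyp_H2 B x w \<longleftrightarrow>
     Liminf (at_left 1) (\<lambda>r. ereal \<bar>flux_defect B x w r\<bar>) = ereal (norm w) \<and>
     Limsup (at_left 1) (\<lambda>r. ereal ((\<bar>flux_defect B x w r\<bar> - norm w) / (r - 1))) < 0"

end

theory Submission
  imports Defs
begin

text \<open>
  The speed is conserved, and so is the sum of \<open>pdet q v\<close> and the normalised flux of B through
  the disc of radius \<open>norm q\<close>. Hence at any time with \<open>r = norm (q t) \<ge> norm (q 0)\<close> the flux defect
  at r equals \<open>- pdet (q t) (v t)\<close>, whose absolute value is at most \<open>r * norm (v 0)\<close>. Either hypothesis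
  forces the flux defect to exceed \<open>norm (v 0)\<close> in absolute value for all r close to 1, so the
  trajectory never enters a neighbourhood of the unit circle. Position and velocity then remain in
  a compact subset of phase space on which the vector field is Lipschitz, and a solution with
  finite lifespan could be extended.
\<close>

section \<open>Ordinary differential equations with Lipschitz right-hand side\<close>

lemma ode_solution_exists_lipschitz:
  fixes g :: "'a::banach \<Rightarrow> 'a"
  assumes lip: "L-lipschitz_on UNIV g" and S: "0 \<le> S"
  obtains y where "y 0 = x0"
    and "\<And>t. t \<in> {0..S} \<Longrightarrow> (y has_vector_derivative g (y t)) (at t within {0..S})"
proof -
  define K where "K = L + 1"
  have K: "0 < K" "L \<le> K"
    using lipschitz_on_nonneg[OF lip] by (auto simp: K_def)
  have g_lip: "norm (g x - g y) \<le> K * norm (x - y)" for x y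
    using lipschitz_on_le[OF lip K(2)] lipschitz_on_normD by blast
  have cont_g: "continuous_on X g" for X
    using lipschitz_on_continuous_on[OF lip] continuous_on_subset by blast
  define h where "h z s = g (exp (2 * K * s) *\<^sub>R z s)" for z :: "real \<Rightarrow> 'a" and s
  \<comment> \<open>Picard's operator conjugated by \<open>z t = exp (- 2 K t) y t\<close>: with this weight it contracts by 1/2
    whatever the length S of the interval, so no continuation argument is needed.\<close>
  define P where "P z t = exp (- (2 * K * t)) *\<^sub>R (x0 + integral {0..t} (h z))"
    for z :: "real \<Rightarrow> 'a" and t
  \<comment> \<open>Clamping time to \<open>{0..S}\<close> turns \<open>P z\<close> into a bounded
    continuous function on the whole line, so the fixed point can be sought in the complete space of
    such functions.\<close>
  define c where "c t = max 0 (min t S)" for t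
  have c: "c t \<in> {0..S}" for t
    using S by (auto simp: c_def)
  have cont_c: "continuous_on UNIV c"
    unfolding c_def by (intro continuous_intros)
  have cont_h: "continuous_on X (h (apply_bcontfun z))" for X z
    unfolding h_def by (intro continuous_on_compose2[OF cont_g[of UNIV]] continuous_intros) auto
  have h_int: "h (apply_bcontfun z) integrable_on {a..b}" for z a b
    by (intro integrable_continuous_real cont_h)
  have cont_P: "continuous_on {0..S} (P (apply_bcontfun z))" for z
    unfolding P_def by (intro continuous_intros indefinite_integral_continuous_1 h_int)
  have bc: "(\<lambda>t. P (apply_bcontfun z) (c t)) \<in> bcontfun" for z
  proof -
    have "continuous_on UNIV (\<lambda>t. P (apply_bcontfun z) (c t))"
      by (rule continuous_on_compose2[OF cont_P cont_c]) (use c in auto)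
    moreover have "bounded (P (apply_bcontfun z) ` {0..S})"
      by (intro compact_imp_bounded compact_continuous_image cont_P) auto
    then have "bounded (range (\<lambda>t. P (apply_bcontfun z) (c t)))"
      by (rule bounded_subset) (use c in auto)
    ultimately show ?thesis by (auto simp: bcontfun_def)
  qed
  define \<Phi> where "\<Phi> z = Bcontfun (\<lambda>t. P (apply_bcontfun z) (c t))" for z :: "real \<Rightarrow>\<^sub>C 'a"
  have \<Phi>: "apply_bcontfun (\<Phi> z) t = P (apply_bcontfun z) (c t)" for z t
    unfolding \<Phi>_def by (simp add: Bcontfun_inverse[OF bc])
  have contr: "dist (\<Phi> z) (\<Phi> w) \<le> 1/2 * dist z w" for z w
  proof (rule dist_bound)
    fix t
    define s where "s = c t"
    have s: "0 \<le> s" using c[of t] by (auto simp: s_def)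
    \<comment> \<open>The Lipschitz bound contributes K times the weight, whose integral is at most
      \<open>exp (2 * K * s) / 2\<close>; the prefactor \<open>exp (- (2 * K * s))\<close> of P
      cancels the exponential and leaves 1/2.\<close>
    have exp_int: "((\<lambda>r. K * exp (2 * K * r) * dist z w) has_integral
        exp (2 * K * s) / 2 * dist z w - exp (2 * K * 0) / 2 * dist z w) {0..s}"
      by (intro fundamental_theorem_of_calculus s)
        (auto intro!: derivative_eq_intros simp: has_real_derivative_iff_has_vector_derivative[symmetric])
    have "norm (integral {0..s} (h z) - integral {0..s} (h w))
        = norm (integral {0..s} (\<lambda>r. h z r - h w r))"
      by (simp add: integral_diff h_int)
    also have "\<dots> \<le> integral {0..s} (\<lambda>r. K * exp (2 * K * r) * dist z w)"
    proof (rule Henstock_Kurzweil_Integration.integral_norm_bound_integral)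
      show "(\<lambda>r. h z r - h w r) integrable_on {0..s}"
        by (intro integrable_diff h_int)
      show "(\<lambda>r. K * exp (2 * K * r) * dist z w) integrable_on {0..s}"
        using exp_int by blast
      fix r assume "r \<in> {0..s}"
      have "norm (h z r - h w r) \<le> K * norm (exp (2 * K * r) *\<^sub>R z r - exp (2 * K * r) *\<^sub>R w r)"
        unfolding h_def by (rule g_lip)
      also have "\<dots> = K * (exp (2 * K * r) * dist (z r) (w r))"
        by (simp add: scaleR_diff_right[symmetric] dist_norm)
      also have "\<dots> \<le> K * (exp (2 * K * r) * dist z w)"
        using K by (intro mult_left_mono dist_bounded) auto
      finally show "norm (h z r - h w r) \<le> K * exp (2 * K * r) * dist z w" by simp
    qed
    also have "\<dots> = exp (2 * K * s) / 2 * dist z w - exp (2 * K * 0) / 2 * dist z w"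
      using exp_int by (rule integral_unique)
    also have "\<dots> \<le> exp (2 * K * s) / 2 * dist z w" by simp
    finally have *: "norm (integral {0..s} (h z) - integral {0..s} (h w))
      \<le> exp (2 * K * s) / 2 * dist z w" .
    have "dist (\<Phi> z t) (\<Phi> w t)
        = exp (- (2 * K * s)) * norm (integral {0..s} (h z) - integral {0..s} (h w))"
      by (simp add: \<Phi> P_def s_def[symmetric] dist_norm scaleR_diff_right[symmetric])
    also have "\<dots> \<le> exp (- (2 * K * s)) * (exp (2 * K * s) / 2 * dist z w)"
      by (intro mult_left_mono *) auto
    also have "\<dots> = 1/2 * dist z w"
      by (simp add: exp_minus field_simps)
    finally show "dist (\<Phi> z t) (\<Phi> w t) \<le> 1/2 * dist z w" .
  qed
  then obtain z where z: "\<Phi> z = z"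
    using banach_fix_type[of "1/2" \<Phi>] by auto
  \<comment> \<open>Undoes the conjugation: on \<open>{0..S}\<close> the clamp is the identity, so
    the fixed-point equation identifies the rescaled z with y, and the integrand
    \<open>h z t\<close> becomes \<open>g (y t)\<close>.\<close>
  define y where "y t = x0 + integral {0..t} (h z)" for t
  have zy: "exp (2 * K * t) *\<^sub>R z t = y t" if "t \<in> {0..S}" for t
  proof -
    have "c t = t" using that by (auto simp: c_def)
    then have "z t = exp (- (2 * K * t)) *\<^sub>R y t"
      using \<Phi>[of z t] by (simp add: z P_def y_def)
    then show ?thesis by (simp add: exp_minus)
  qed
  show ?thesis
  proof
    show "y 0 = x0" by (simp add: y_def)
    fix t assume t: "t \<in> {0..S}"
    have "(y has_vector_derivative 0 + h z t) (at t within {0..S})"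
      unfolding y_def
      by (intro has_vector_derivative_add has_vector_derivative_const
          integral_has_vector_derivative cont_h t)
    then show "(y has_vector_derivative g (y t)) (at t within {0..S})"
      by (simp add: h_def zy[OF t])
  qed
qed

text \<open>Gronwall's argument: the squared distance of the two solutions grows at rate at most 2
  L, so after weighting with \<open>exp (- (2 * L * t))\<close> it is nonincreasing. It starts at
  0.\<close>

lemma ode_solution_unique_lipschitz:
  fixes g :: "'a::real_inner \<Rightarrow> 'a"
  assumes lip: "L-lipschitz_on UNIV g"
    and x: "\<And>t. t \<in> {0..S} \<Longrightarrow> (x has_vector_derivative g (x t)) (at t within {0..S})"
    and y: "\<And>t. t \<in> {0..S} \<Longrightarrow> (y has_vector_derivative g (y t)) (at t within {0..S})"
    and "x 0 = y 0" and t: "t \<in> {0..S}"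
  shows "x t = y t"
proof -
  define u where "u t = exp (- (2 * L * t)) * ((x t - y t) \<bullet> (x t - y t))" for t
  define u' where "u' t = exp (- (2 * L * t)) *
    (2 * ((x t - y t) \<bullet> (g (x t) - g (y t))) - 2 * L * ((x t - y t) \<bullet> (x t - y t)))" for t
  have u: "(u has_real_derivative u' s) (at s within {0..t})" if "s \<in> {0..t}" for s
  proof -
    have sub: "{0..t} \<subseteq> {0..S}" and s: "s \<in> {0..S}" using t that by auto
    have "((\<lambda>s. x s - y s) has_derivative (\<lambda>h. h *\<^sub>R (g (x s) - g (y s)))) (at s within {0..t})"
      using has_vector_derivative_within_subset[OF has_vector_derivative_diff[OF x[OF s] y[OF s]] sub]
      by (simp add: has_vector_derivative_def)
    from has_derivative_inner[OF this this]
    have sq: "((\<lambda>s. (x s - y s) \<bullet> (x s - y s)) has_real_derivative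
        2 * ((x s - y s) \<bullet> (g (x s) - g (y s)))) (at s within {0..t})"
      unfolding has_field_derivative_def
      by (rule has_derivative_eq_rhs) (auto simp: inner_commute fun_eq_iff)
    have "((\<lambda>s. exp (- (2 * L * s))) has_real_derivative - (2 * L) * exp (- (2 * L * s)))
        (at s within {0..t})"
      by (auto intro!: derivative_eq_intros)
    from DERIV_mult[OF this sq] show ?thesis
      unfolding u_def u'_def by (rule DERIV_cong) (simp add: algebra_simps)
  qed
  have u'_le: "u' s \<le> 0" for s
  proof -
    have "(x s - y s) \<bullet> (g (x s) - g (y s)) \<le> norm (x s - y s) * norm (g (x s) - g (y s))"
      by (rule norm_cauchy_schwarz)
    also have "\<dots> \<le> norm (x s - y s) * (L * norm (x s - y s))"
      by (intro mult_left_mono lipschitz_on_normD[OF lip]) auto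
    also have "\<dots> = L * ((x s - y s) \<bullet> (x s - y s))"
      by (simp add: power2_norm_eq_inner[symmetric] power2_eq_square)
    finally show ?thesis
      unfolding u'_def by (intro mult_nonneg_nonpos) auto
  qed
  obtain s where "u t - u 0 = u' s * (t - 0)"
    using mvt_very_simple[of 0 t u "\<lambda>s. (*) (u' s)"] u t
    by (auto simp: has_field_derivative_def)
  moreover have "u' s * t \<le> 0"
    using t u'_le[of s] by (simp add: mult_nonpos_nonneg)
  moreover have "u 0 = 0" using assms by (simp add: u_def)
  ultimately have "u t \<le> 0" by simp
  then have "(x t - y t) \<bullet> (x t - y t) \<le> 0"
    by (simp add: u_def mult_le_0_iff not_le[symmetric])
  then show ?thesis
    by (metis eq_iff_diff_eq_0 inner_eq_zero_iff inner_ge_zero order_antisym)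
qed

text \<open>Serves to contradict the maximality of a finite lifespan. C confines the trajectory, and
  K is a larger set where the field is Lipschitz; the gap between them leaves room beyond S.
  Convexity of K makes the nearest-point projection 1-Lipschitz.\<close>

lemma ode_extension_lipschitz:
  fixes f :: "'a::euclidean_space \<Rightarrow> 'a"
  assumes lip: "L-lipschitz_on K f" and "convex K" "closed K"
    and "closed C" and C: "C \<subseteq> interior K" and "0 < S"
    and x: "\<And>t. t \<in> {0..<S} \<Longrightarrow> (x has_vector_derivative f (x t)) (at t within {0..<S})"
    and xC: "\<And>t. t \<in> {0..<S} \<Longrightarrow> x t \<in> C"
  obtains S' y where "S < S'" and "\<And>t. t \<in> {0..<S} \<Longrightarrow> y t = x t"
    and "\<And>t. t \<in> {0..<S'} \<Longrightarrow> y t \<in> K"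
    and "\<And>t. t \<in> {0..<S'} \<Longrightarrow> (y has_vector_derivative f (y t)) (at t within {0..<S'})"
proof -
  have CK: "C \<subseteq> K" using C interior_subset by blast
  then have K: "K \<noteq> {}" using xC[of 0] \<open>0 < S\<close> by auto
  \<comment> \<open>Composing with the projection onto K gives a globally Lipschitz field; its solution past S
    coincides with x before S and stays in K for a little longer.\<close>
  define g where "g = f \<circ> closest_point K"
  have gf: "g z = f z" if "z \<in> K" for z
    using that by (simp add: g_def closest_point_self)
  have "1-lipschitz_on UNIV (closest_point K)"
    using closest_point_lipschitz[OF assms(2,3) K] by (auto intro!: lipschitz_onI)
  moreover have "L-lipschitz_on (range (closest_point K)) f"
    by (rule lipschitz_on_subset[OF lip]) (use closest_point_in_set[OF assms(3) K] in auto)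
  ultimately have lip_g: "L-lipschitz_on UNIV g"
    using lipschitz_on_compose[of 1 UNIV "closest_point K" L f] by (simp add: g_def)
  obtain y where y0: "y 0 = x 0"
    and y: "\<And>t. t \<in> {0..S+1} \<Longrightarrow> (y has_vector_derivative g (y t)) (at t within {0..S+1})"
    using ode_solution_exists_lipschitz[OF lip_g, of "S+1" "x 0"] \<open>0 < S\<close> by auto
  \<comment> \<open>The equation for x is known only before S, so uniqueness is applied on
    \<open>{0..t}\<close> for each t < S separately.\<close>
  have yx: "y t = x t" if t: "t \<in> {0..<S}" for t
  proof (rule ode_solution_unique_lipschitz[OF lip_g, where S = t])
    fix s assume s: "s \<in> {0..t}"
    show "(y has_vector_derivative g (y s)) (at s within {0..t})"
      by (rule has_vector_derivative_within_subset[OF y]) (use s t in auto)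
    have "g (x s) = f (x s)" using s t xC[of s] CK by (auto intro!: gf)
    then show "(x has_vector_derivative g (x s)) (at s within {0..t})"
      using has_vector_derivative_within_subset[OF x, of s "{0..t}"] s t by (auto simp: subset_eq)
  qed (use t y0 in auto)
  have cont_y: "continuous_on {0..S+1} y"
    using has_vector_derivative_continuous[OF y] by (simp add: continuous_on_eq_continuous_within)
  \<comment> \<open>The closure adds the endpoint S: continuity of y and closedness of C put
    \<open>y S\<close> into C, hence into the interior of K.\<close>
  have "y ` closure {0..<S} \<subseteq> C"
    by (rule image_closure_subset)
      (use \<open>0 < S\<close> \<open>closed C\<close> xC yx in \<open>auto intro: continuous_on_subset[OF cont_y]\<close>)
  then have "y S \<in> interior K" using C \<open>0 < S\<close> by (auto simp: image_subset_iff)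
  then obtain e where "e > 0" and e: "ball (y S) e \<subseteq> K"
    using mem_interior by blast
  then obtain d where "d > 0"
    and d: "\<And>t. t \<in> {0..S+1} \<Longrightarrow> dist t S < d \<Longrightarrow> dist (y t) (y S) < e"
    using cont_y \<open>0 < S\<close> unfolding continuous_on_iff
    by (metis atLeastAtMost_iff le_add_same_cancel1 less_eq_real_def zero_le_one)
  \<comment> \<open>The first bound keeps to the interval where y solves the projected equation, the
    second to times when y is still in K.\<close>
  define S' where "S' = min (S + 1) (S + d)"
  have yK: "y t \<in> K" if t: "t \<in> {0..<S'}" for t
  proof (cases "t < S")
    case True
    then show ?thesis using yx[of t] xC[of t] CK t by auto
  next
    case False
    then have "dist (y t) (y S) < e"
      using t by (intro d) (auto simp: S'_def dist_real_def)
    then show ?thesis using e by (auto simp: dist_commute)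
  qed
  show ?thesis
  proof
    show "S < S'" using \<open>d > 0\<close> by (simp add: S'_def)
    show "(y has_vector_derivative f (y t)) (at t within {0..<S'})" if t: "t \<in> {0..<S'}" for t
      using has_vector_derivative_within_subset[OF y, of t "{0..<S'}"] t gf[OF yK[OF t]]
      by (auto simp: S'_def subset_eq)
  qed (use yx yK in auto)
qed

section \<open>Flux of a radial field through discs\<close>

text \<open>
  The argument is the squared radius, so that \<open>disc_flux B ((norm (q t))\<^sup>2)\<close> stays differentiable
  when the trajectory passes through the origin. The derivative only needs the areas of annuli,
  not polar coordinates.
\<close>
definition disc_flux :: "(real^2 \<Rightarrow> real) \<Rightarrow> real \<Rightarrow> real" where
  "disc_flux B s = 1 / (2 * pi) * (LINT y:cball 0 (sqrt s)|lborel. B y)"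

lemma set_integrable_cball:
  fixes B :: "'a::euclidean_space \<Rightarrow> real"
  assumes "continuous_on (ball 0 1) B" "r < 1"
  shows "set_integrable lborel (cball 0 r) B"
  unfolding set_integrable_def
  by (rule borel_integrable_compact) (use assms in \<open>auto intro: continuous_on_subset\<close>)

text \<open>The annulus between squared radii s and t has area \<open>pi * (t - s)\<close>, so a
  constant field c would contribute exactly \<open>c / 2 * (t - s)\<close> after division by
  \<open>2 * pi\<close>. Bounding B by \<open>c - \<epsilon>\<close> and
  \<open>c + \<epsilon>\<close> on the annulus gives the error.\<close>

lemma disc_flux_diff_bound:
  assumes cont: "continuous_on unit_disc B" and st: "0 \<le> s" "s \<le> t" "t < 1"
    and c: "\<And>y. s \<le> (norm y)\<^sup>2 \<Longrightarrow> (norm y)\<^sup>2 \<le> t \<Longrightarrow> \<bar>B y - c\<bar> \<le> \<epsilon>"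
  shows "\<bar>disc_flux B t - disc_flux B s - c / 2 * (t - s)\<bar> \<le> \<epsilon> / 2 * (t - s)"
proof -
  define A where "A = cball (0::real^2) (sqrt t) - cball 0 (sqrt s)"
  have sub: "cball (0::real^2) (sqrt s) \<subseteq> cball 0 (sqrt t)"
    using st by (intro subset_cball) auto
  have area: "measure lborel (cball (0::real^2) (sqrt r)) = pi * r" if "0 \<le> r" for r
    using that by (simp add: content_cball unit_ball_vol_2)
  have fin: "emeasure lborel (cball (0::real^2) r) < \<infinity>" for r
    using emeasure_lborel_cball_finite by auto
  have finA: "emeasure lborel A < \<infinity>"
    by (rule le_less_trans[OF emeasure_mono fin[of "sqrt t"]]) (auto simp: A_def)
  have mA: "measure lborel A = pi * (t - s)"
    unfolding A_def using fin[of "sqrt t"] sub st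
    by (subst measure_Diff) (auto simp: area algebra_simps)
  have B_t: "set_integrable lborel (cball 0 (sqrt t)) B"
    using cont st by (intro set_integrable_cball) auto
  have B_s: "set_integrable lborel (cball 0 (sqrt s)) B"
    using cont st by (intro set_integrable_cball) auto
  have B_A: "set_integrable lborel A B"
    by (rule set_integrable_subset[OF B_t]) (auto simp: A_def)
  have const: "set_integrable lborel A (\<lambda>_. k)" for k :: real
    using finA by (auto simp: set_integrable_def A_def)
  have const_eq: "(LINT y:A|lborel. k) = pi * (t - s) * k" for k :: real
    using finA set_integral_const[of A lborel k] by (simp add: mA) (simp add: A_def)
  have "(LINT y:cball 0 (sqrt t)|lborel. B y)
      = (LINT y:cball 0 (sqrt s)|lborel. B y) + (LINT y:A|lborel. B y)"
    by (subst set_integral_Un[symmetric])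
      (use B_s B_A sub in \<open>auto simp: A_def Un_absorb1\<close>)
  then have diff: "disc_flux B t - disc_flux B s = 1 / (2 * pi) * (LINT y:A|lborel. B y)"
    by (simp add: disc_flux_def field_simps)
  have bnd: "c - \<epsilon> \<le> B y" "B y \<le> c + \<epsilon>" if "y \<in> A" for y
  proof -
    have "sqrt s < norm y" "norm y \<le> sqrt t" using that by (auto simp: A_def)
    then have "s \<le> (norm y)\<^sup>2" "(norm y)\<^sup>2 \<le> t"
      using st power_mono[of "norm y" "sqrt t" 2] by (auto intro: sqrt_le_D)
    from c[OF this] show "c - \<epsilon> \<le> B y" "B y \<le> c + \<epsilon>" by auto
  qed
  have "pi * (t - s) * (c - \<epsilon>) \<le> (LINT y:A|lborel. B y)"
    unfolding const_eq[symmetric] by (intro set_integral_mono const B_A bnd)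
  moreover have "(LINT y:A|lborel. B y) \<le> pi * (t - s) * (c + \<epsilon>)"
    unfolding const_eq[symmetric] by (intro set_integral_mono const B_A bnd)
  ultimately have "\<bar>(LINT y:A|lborel. B y) - pi * (t - s) * c\<bar> \<le> pi * (t - s) * \<epsilon>"
    by (simp add: abs_le_iff algebra_simps)
  then have "\<bar>(LINT y:A|lborel. B y) - pi * (t - s) * c\<bar> / (2 * pi) \<le> pi * (t - s) * \<epsilon> / (2 * pi)"
    by (rule divide_right_mono) simp
  also have "\<dots> = \<epsilon> / 2 * (t - s)" by simp
  also have "\<bar>(LINT y:A|lborel. B y) - pi * (t - s) * c\<bar> / (2 * pi)
      = \<bar>((LINT y:A|lborel. B y) - pi * (t - s) * c) / (2 * pi)\<bar>"
    by (simp add: abs_divide)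
  also have "((LINT y:A|lborel. B y) - pi * (t - s) * c) / (2 * pi)
      = disc_flux B t - disc_flux B s - c / 2 * (t - s)"
    unfolding diff by (simp add: diff_divide_distrib mult.commute)
  finally show ?thesis .
qed

text \<open>Radial symmetry lets y be replaced by the point of equal norm on the ray through x,
  whose distance to x is the difference of the norms. The origin has no such ray, but there the
  difference of the norms already is the distance.\<close>

lemma radial_on_continuous_norm:
  assumes "radial_on unit_disc B" "continuous_on unit_disc B" and x: "norm x < 1" and "0 < \<epsilon>"
  obtains d where "0 < d"
    and "\<And>y::real^2. norm y < 1 \<Longrightarrow> \<bar>norm y - norm x\<bar> < d \<Longrightarrow> \<bar>B y - B x\<bar> < \<epsilon>"
proof -
  have "x \<in> unit_disc" using x by simp
  with assms(2) \<open>0 < \<epsilon>\<close> obtain d where "0 < d"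
    and d: "\<forall>y\<in>unit_disc. dist y x < d \<longrightarrow> dist (B y) (B x) < \<epsilon>"
    unfolding continuous_on_iff by blast
  have d: "\<bar>B y - B x\<bar> < \<epsilon>" if "norm y < 1" "dist y x < d" for y
    using d that by (simp add: dist_real_def)
  show ?thesis
  proof
    fix y :: "real^2" assume y: "norm y < 1" "\<bar>norm y - norm x\<bar> < d"
    show "\<bar>B y - B x\<bar> < \<epsilon>"
    proof (cases "x = 0")
      case True
      then show ?thesis using y by (intro d) auto
    next
      case False
      define z where "z = (norm y / norm x) *\<^sub>R x"
      have nz: "norm z = norm y" using False by (simp add: z_def)
      have "z - x = ((norm y - norm x) / norm x) *\<^sub>R x"
        using False by (simp add: z_def diff_divide_distrib scaleR_diff_left)
      then have "dist z x = \<bar>norm y - norm x\<bar>" using False by (simp add: dist_norm)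
      then have "\<bar>B z - B x\<bar> < \<epsilon>" using nz y by (intro d) auto
      moreover have "B z = B y"
        using assms(1)[unfolded radial_on_def, rule_format, of z y] nz y by simp
      ultimately show ?thesis by simp
    qed
  qed fact
qed

lemma disc_flux_has_derivative:
  assumes rad: "radial_on unit_disc B" and cont: "continuous_on unit_disc B" and x: "norm x < 1"
  shows "(disc_flux B has_real_derivative B x / 2) (at ((norm x)\<^sup>2) within {0..<1})"
  unfolding has_field_derivative_def has_derivative_within_alt
proof (intro conjI allI impI)
  show "bounded_linear ((*) (B x / 2))" by (rule bounded_linear_mult_right)
  fix e :: real assume "0 < e"
  \<comment> \<open>The tolerance \<open>2 * e\<close> is halved by
    \<open>disc_flux_diff_bound\<close>.\<close>
  obtain d where "0 < d"
    and d: "\<And>y::real^2. norm y < 1 \<Longrightarrow> \<bar>norm y - norm x\<bar> < d \<Longrightarrow> \<bar>B y - B x\<bar> < 2 * e"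
    using radial_on_continuous_norm[OF rad cont x, of "2 * e"] \<open>0 < e\<close> by auto
  \<comment> \<open>Converts closeness of squared radii into closeness of radii, also at radius 0,
    where the square root is continuous but not Lipschitz.\<close>
  have "isCont sqrt ((norm x)\<^sup>2)" by (rule isCont_real_sqrt)
  then obtain k where "0 < k"
    and k: "\<And>s. dist s ((norm x)\<^sup>2) < k \<Longrightarrow> dist (sqrt s) (sqrt ((norm x)\<^sup>2)) < d"
    using \<open>0 < d\<close> unfolding continuous_at_eps_delta dist_real_def by blast
  show "\<exists>k>0. \<forall>s\<in>{0..<1}. norm (s - (norm x)\<^sup>2) < k \<longrightarrow>
      norm (disc_flux B s - disc_flux B ((norm x)\<^sup>2) - B x / 2 * (s - (norm x)\<^sup>2))
        \<le> e * norm (s - (norm x)\<^sup>2)"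
  proof (intro exI[of _ k] conjI ballI impI \<open>0 < k\<close>)
    fix s :: real assume s: "s \<in> {0..<1}" "norm (s - (norm x)\<^sup>2) < k"
    define a b where "a = min s ((norm x)\<^sup>2)" and "b = max s ((norm x)\<^sup>2)"
    have ab: "0 \<le> a" "a \<le> b" "b < 1"
      using s x by (auto simp: a_def b_def power_less_one_iff)
    have "\<bar>B y - B x\<bar> \<le> 2 * e" if "a \<le> (norm y)\<^sup>2" "(norm y)\<^sup>2 \<le> b" for y
    proof -
      have "(norm y)\<^sup>2 < 1" using that ab by simp
      then have "norm y < 1" by (simp add: power_less_one_iff)
      moreover have "dist ((norm y)\<^sup>2) ((norm x)\<^sup>2) < k"
        using that s by (simp add: a_def b_def dist_real_def)
      from k[OF this] have "\<bar>norm y - norm x\<bar> < d" by (simp add: dist_real_def)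
      ultimately show ?thesis using d[of y] by simp
    qed
    then have *: "\<bar>disc_flux B b - disc_flux B a - B x / 2 * (b - a)\<bar> \<le> 2 * e / 2 * (b - a)"
      by (intro disc_flux_diff_bound cont ab)
    show "norm (disc_flux B s - disc_flux B ((norm x)\<^sup>2) - B x / 2 * (s - (norm x)\<^sup>2))
        \<le> e * norm (s - (norm x)\<^sup>2)"
    proof (cases "(norm x)\<^sup>2 \<le> s")
      case True
      then show ?thesis using * by (simp add: a_def b_def)
    next
      case False
      then show ?thesis using * by (simp add: a_def b_def abs_le_iff algebra_simps)
    qed
  qed
qed

text \<open>The annulus in \<open>flux_defect\<close> contains its inner circle, which the
  difference of closed discs omits; circles are null sets.\<close>

lemma flux_defect_eq_disc_flux:
  assumes cont: "continuous_on unit_disc B" and r: "norm x \<le> r" "r < 1"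
  shows "flux_defect B x w r = disc_flux B (r\<^sup>2) - disc_flux B ((norm x)\<^sup>2) - pdet x w"
proof -
  define A where "A = {y::real^2. norm x \<le> norm y \<and> norm y \<le> r}"
  have r0: "0 \<le> r" using r norm_ge_zero[of x] by linarith
  have A: "A = cball 0 r - ball 0 (norm x)" by (auto simp: A_def)
  have I: "set_integrable lborel (cball 0 r) B" and J: "set_integrable lborel (cball 0 (norm x)) B"
    using cont r by (auto intro!: set_integrable_cball)
  have ball: "set_integrable lborel (ball 0 (norm x)) B"
    by (rule set_integrable_subset[OF J]) auto
  have IA: "set_integrable lborel A B"
    by (rule set_integrable_subset[OF I]) (auto simp: A)
  have "sphere (0::real^2) (norm x) \<in> null_sets lborel"
    using negligible_sphere[of "0::real^2" "norm x"]
    by (auto simp: null_sets_completion_iff negligible_iff_null_sets)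
  then have "AE y in lborel. y \<notin> sphere (0::real^2) (norm x)" by (rule AE_not_in)
  then have "(LINT y:ball 0 (norm x)|lborel. B y) = (LINT y:cball 0 (norm x)|lborel. B y)"
    by (intro set_integral_cong_set)
      (use ball J in \<open>auto simp: set_borel_measurable_def set_integrable_def elim!: eventually_mono\<close>)
  moreover have "ball 0 (norm x) \<union> A = cball 0 r"
    using r by (auto simp: A_def)
  then have "(LINT y:cball 0 r|lborel. B y)
      = (LINT y:ball 0 (norm x)|lborel. B y) + (LINT y:A|lborel. B y)"
    by (metis A Diff_disjoint IA ball set_integral_Un)
  ultimately show ?thesis
    using r0 by (simp add: flux_defect_def disc_flux_def A_def[symmetric] field_simps)
qed

section \<open>Conserved quantities and confinement\<close>

text \<open>From Lagrange's identity: the squares of the determinant and of the inner product add up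
  to the product of the squared norms.\<close>

lemma abs_pdet_le: "\<bar>pdet u w\<bar> \<le> norm u * norm w"
proof -
  have "(pdet u w)\<^sup>2 + (u \<bullet> w)\<^sup>2 = (u \<bullet> u) * (w \<bullet> w)"
    by (simp add: pdet_def inner_vec_def sum_2 power2_eq_square algebra_simps)
  then have "(pdet u w)\<^sup>2 \<le> (norm u * norm w)\<^sup>2"
    by (simp add: power_mult_distrib power2_norm_eq_inner) (metis le_add_same_cancel1 zero_le_power2)
  then show ?thesis by (rule abs_le_square_iff[THEN iffD2, THEN order_trans]) simp
qed

lemma convex_time_dom: "convex (time_dom T)"
proof -
  have "is_interval (time_dom T)"
    unfolding is_interval_1 time_dom_def
    by (auto intro: order.strict_trans1[of "ereal _" "ereal _" T])
  then show ?thesis by (rule is_interval_convex)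
qed

lemma has_real_derivative_zero_constant_on:
  fixes f :: "real \<Rightarrow> real"
  assumes "convex S" "\<And>t. t \<in> S \<Longrightarrow> (f has_real_derivative 0) (at t within S)" "s \<in> S" "t \<in> S"
  shows "f s = f t"
  using has_derivative_zero_constant[of S f] assms by (auto simp: has_field_derivative_def lambda_zero)

lemma power2_norm_real2: "(norm x)\<^sup>2 = (x $ 1)\<^sup>2 + (x $ 2)\<^sup>2" for x :: "real^2"
  by (simp add: norm_vec_def L2_set_def sum_2)

lemma magnetic_solution_componentwise:
  assumes "magnetic_solution B T q v" "t \<in> time_dom T"
  shows "((\<lambda>t. q t $ i) has_real_derivative v t $ i) (at t within time_dom T)"
    and "((\<lambda>t. v t $ 1) has_real_derivative B (q t) * v t $ 2) (at t within time_dom T)"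
    and "((\<lambda>t. v t $ 2) has_real_derivative - B (q t) * v t $ 1) (at t within time_dom T)"
proof -
  have q: "(q has_vector_derivative v t) (at t within time_dom T)"
    and v: "(v has_vector_derivative B (q t) *\<^sub>R vector [v t $ 2, - (v t $ 1)])
      (at t within time_dom T)"
    using assms by (auto simp: magnetic_solution_def)
  note comp = bounded_linear.has_vector_derivative[OF bounded_linear_vec_nth]
  show "((\<lambda>t. q t $ i) has_real_derivative v t $ i) (at t within time_dom T)"
    using comp[OF q, of i] by (simp add: has_real_derivative_iff_has_vector_derivative)
  show "((\<lambda>t. v t $ 1) has_real_derivative B (q t) * v t $ 2) (at t within time_dom T)"
    using comp[OF v, of 1] by (simp add: has_real_derivative_iff_has_vector_derivative)
  show "((\<lambda>t. v t $ 2) has_real_derivative - B (q t) * v t $ 1) (at t within time_dom T)"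
    using comp[OF v, of 2] by (simp add: has_real_derivative_iff_has_vector_derivative)
qed

text \<open>The magnetic force is orthogonal to the velocity and does no work.\<close>

lemma magnetic_speed_constant:
  assumes sol: "magnetic_solution B T q v" and t: "t \<in> time_dom T"
  shows "norm (v t) = norm (v 0)"
proof -
  have "0 \<in> time_dom T" using sol by (simp add: time_dom_def magnetic_solution_def zero_ereal_def)
  have "(norm (v t))\<^sup>2 = (norm (v 0))\<^sup>2"
  proof (rule has_real_derivative_zero_constant_on[OF convex_time_dom _ t \<open>0 \<in> time_dom T\<close>])
    fix t assume "t \<in> time_dom T"
    from magnetic_solution_componentwise(2,3)[OF sol this]
    show "((\<lambda>t. (norm (v t))\<^sup>2) has_real_derivative 0) (at t within time_dom T)"
      unfolding power2_norm_real2 by (auto intro!: derivative_eq_intros simp: algebra_simps)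
  qed
  then show ?thesis by simp
qed

text \<open>The conserved quantity is the canonical angular momentum \<open>pdet q p\<close> in the
  rotationally symmetric gauge, where the vector potential contributes the normalised flux. The
  torque \<open>- B * (q \<bullet> v)\<close> cancels the rate of change of the flux.\<close>

lemma magnetic_momentum_constant:
  assumes rad: "radial_on unit_disc B" and cont: "continuous_on unit_disc B"
    and sol: "magnetic_solution B T q v" and t: "t \<in> time_dom T"
  shows "pdet (q t) (v t) + disc_flux B ((norm (q t))\<^sup>2)
    = pdet (q 0) (v 0) + disc_flux B ((norm (q 0))\<^sup>2)"
proof -
  have "0 \<in> time_dom T" using sol by (simp add: time_dom_def magnetic_solution_def zero_ereal_def)
  show ?thesis
  proof (rule has_real_derivative_zero_constant_on[OF convex_time_dom _ t \<open>0 \<in> time_dom T\<close>])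
    fix t assume t: "t \<in> time_dom T"
    have q1: "norm (q t) < 1" if "t \<in> time_dom T" for t
      using sol that by (auto simp: magnetic_solution_def)
    have sq: "((\<lambda>t. (norm (q t))\<^sup>2) has_real_derivative
        2 * (q t $ 1 * v t $ 1 + q t $ 2 * v t $ 2)) (at t within time_dom T)"
      using magnetic_solution_componentwise(1)[OF sol t, of 1]
        magnetic_solution_componentwise(1)[OF sol t, of 2]
      unfolding power2_norm_real2 by (auto intro!: derivative_eq_intros simp: algebra_simps)
    \<comment> \<open>The chain rule asks for the derivative within the image of the time domain;
      that image lies in \<open>{0..<1}\<close>.\<close>
    have flux: "(disc_flux B has_real_derivative B (q t) / 2)
        (at ((norm (q t))\<^sup>2) within (\<lambda>t. (norm (q t))\<^sup>2) ` time_dom T)"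
      by (rule DERIV_subset[OF disc_flux_has_derivative[OF rad cont q1[OF t]]])
        (use q1 in \<open>auto simp: power_less_one_iff\<close>)
    have d1: "((\<lambda>t. disc_flux B ((norm (q t))\<^sup>2)) has_real_derivative
        B (q t) / 2 * (2 * (q t $ 1 * v t $ 1 + q t $ 2 * v t $ 2))) (at t within time_dom T)"
      using DERIV_image_chain[OF flux sq] by (simp add: o_def)
    have d2: "((\<lambda>t. pdet (q t) (v t)) has_real_derivative
        - B (q t) * (q t $ 1 * v t $ 1 + q t $ 2 * v t $ 2)) (at t within time_dom T)"
      using magnetic_solution_componentwise(1)[OF sol t, of 1]
        magnetic_solution_componentwise(1)[OF sol t, of 2]
        magnetic_solution_componentwise(2,3)[OF sol t]
      unfolding pdet_def by (auto intro!: derivative_eq_intros simp: algebra_simps)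
    show "((\<lambda>t. pdet (q t) (v t) + disc_flux B ((norm (q t))\<^sup>2))
        has_real_derivative 0) (at t within time_dom T)"
      by (rule DERIV_cong[OF DERIV_add[OF d2 d1]]) simp
  qed
qed

text \<open>Under H2 the quotient is eventually negative; since \<open>r - 1\<close> is negative
  too, the numerator is positive.\<close>

lemma flux_defect_eventually_gt_speed:
  assumes "hyp_H1 B x w \<or> hyp_H2 B x w"
  shows "\<forall>\<^sub>F r in at_left 1. norm w < \<bar>flux_defect B x w r\<bar>"
  using assms
proof
  assume "hyp_H1 B x w"
  then show ?thesis
    unfolding hyp_H1_def by (auto dest!: less_LiminfD)
next
  assume "hyp_H2 B x w"
  then have "\<forall>\<^sub>F r in at_left 1. ereal ((\<bar>flux_defect B x w r\<bar> - norm w) / (r - 1)) < 0"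
    unfolding hyp_H2_def by (blast dest: Limsup_lessD)
  moreover have "\<forall>\<^sub>F r in at_left 1. r < (1::real)"
    by (simp add: eventually_at_filter)
  ultimately show ?thesis
    by eventually_elim (auto simp: divide_less_0_iff)
qed

text \<open>The bound is uniform over the whole lifespan, finite or not, so it is available before
  global existence is known.\<close>

lemma magnetic_solution_confined:
  assumes rad: "radial_on unit_disc B" and cont: "continuous_on unit_disc B"
    and sol: "magnetic_solution B T q v"
    and hyp: "hyp_H1 B (q 0) (v 0) \<or> hyp_H2 B (q 0) (v 0)"
  obtains \<rho> where "0 \<le> \<rho>" "\<rho> < 1" "\<And>t. t \<in> time_dom T \<Longrightarrow> norm (q t) \<le> \<rho>"
proof -
  obtain b where "b < 1"
    and b: "\<And>r. b < r \<Longrightarrow> r < 1 \<Longrightarrow> norm (v 0) < \<bar>flux_defect B (q 0) (v 0) r\<bar>"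
    using flux_defect_eventually_gt_speed[OF hyp] eventually_at_left[of 0 "1::real"] by auto
  have q1: "norm (q t) < 1" if "t \<in> time_dom T" for t
    using sol that by (auto simp: magnetic_solution_def)
  have "0 \<in> time_dom T" using sol by (simp add: time_dom_def magnetic_solution_def zero_ereal_def)
  show ?thesis
  proof
    \<comment> \<open>Above b the flux defect exceeds the speed, and above \<open>norm (q 0)\<close>
      it is expressible through \<open>disc_flux\<close>; the maximum secures both.\<close>
    show "0 \<le> max b (norm (q 0))" by (simp add: le_max_iff_disj)
    show "max b (norm (q 0)) < 1" using \<open>b < 1\<close> q1[OF \<open>0 \<in> time_dom T\<close>] by simp
    fix t assume t: "t \<in> time_dom T"
    show "norm (q t) \<le> max b (norm (q 0))"
    proof (rule ccontr)
      assume "\<not> ?thesis"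
      then have r: "b < norm (q t)" "norm (q 0) \<le> norm (q t)" by auto
      have "flux_defect B (q 0) (v 0) (norm (q t)) = - pdet (q t) (v t)"
        using flux_defect_eq_disc_flux[OF cont r(2) q1[OF t], of "v 0"]
          magnetic_momentum_constant[OF rad cont sol t] by simp
      then have "norm (v 0) < \<bar>pdet (q t) (v t)\<bar>"
        using b[OF r(1) q1[OF t]] by simp
      also have "\<dots> \<le> norm (q t) * norm (v 0)"
        using abs_pdet_le[of "q t" "v t"] magnetic_speed_constant[OF sol t] by simp
      also have "\<dots> \<le> norm (v 0)"
        using q1[OF t] by (intro mult_left_le_one_le) auto
      finally show False by simp
    qed
  qed
qed

section \<open>Continuation of trajectories\<close>

definition magnetic_field :: "(real^2 \<Rightarrow> real) \<Rightarrow> (real^2) \<times> (real^2) \<Rightarrow> (real^2) \<times> (real^2)" where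
  "magnetic_field B p = (snd p, B (fst p) *\<^sub>R vector [snd p $ 2, - (snd p $ 1)])"

lemma magnetic_solution_iff_phase_space:
  "magnetic_solution B T q v \<longleftrightarrow> 0 < T \<and> (\<forall>t\<in>time_dom T. q t \<in> unit_disc \<and>
    ((\<lambda>t. (q t, v t)) has_vector_derivative magnetic_field B (q t, v t)) (at t within time_dom T))"
proof -
  have "((\<lambda>t. (q t, v t)) has_vector_derivative (a, b)) (at t within X) \<longleftrightarrow>
      (q has_vector_derivative a) (at t within X) \<and> (v has_vector_derivative b) (at t within X)"
    for a b t X
  proof
    assume qv: "((\<lambda>t. (q t, v t)) has_vector_derivative (a, b)) (at t within X)"
    show "(q has_vector_derivative a) (at t within X) \<and> (v has_vector_derivative b) (at t within X)"
      using bounded_linear.has_vector_derivative[OF bounded_linear_fst qv]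
        bounded_linear.has_vector_derivative[OF bounded_linear_snd qv] by simp
  qed (auto intro: has_vector_derivative_Pair)
  then show ?thesis
    by (simp add: magnetic_solution_def magnetic_field_def)
qed

text \<open>The velocity enters through the rotation J, a linear isometry. A product B J is
  Lipschitz here because B is bounded and Lipschitz on a compact disc and the velocity is
  bounded.\<close>

lemma magnetic_field_lipschitz:
  assumes lip: "local_lipschitz (UNIV :: real set) unit_disc (\<lambda>_. B)" and "\<rho> < 1"
  obtains L where "L-lipschitz_on (cball 0 \<rho> \<times> cball 0 M) (magnetic_field B)"
proof -
  define J :: "real^2 \<Rightarrow> real^2" where "J w = vector [w $ 2, - (w $ 1)]" for w
  have J_norm: "norm (J w) = norm w" for w
    by (simp add: J_def norm_vec_def L2_set_def sum_2 add.commute)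
  have J_diff: "J w - J z = J (w - z)" for w z
    by (simp add: J_def vec_eq_iff forall_2)
  have sub: "cball (0::real^2) \<rho> \<subseteq> unit_disc" using \<open>\<rho> < 1\<close> by auto
  \<comment> \<open>Time is a dummy parameter; restricting it to a singleton makes both parameter
    sets compact.\<close>
  have "local_lipschitz {0::real} (cball 0 \<rho>) (\<lambda>_. B)"
    by (rule local_lipschitz_subset[OF lip]) (use sub in auto)
  then obtain L where L: "L-lipschitz_on (cball 0 \<rho>) B"
    by (rule local_lipschitz_compact_implies_lipschitz) auto
  have "bounded (B ` cball 0 \<rho>)"
    by (intro compact_imp_bounded compact_continuous_image lipschitz_on_continuous_on[OF L]) auto
  then obtain N where "0 < N" and N: "\<And>x. x \<in> cball 0 \<rho> \<Longrightarrow> \<bar>B x\<bar> \<le> N"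
    unfolding bounded_pos by auto
  have "0 \<le> L" using lipschitz_on_nonneg[OF L] .
  have "(N + L * \<bar>M\<bar>)-lipschitz_on (cball 0 \<rho> \<times> cball 0 M) (\<lambda>p. B (fst p) *\<^sub>R J (snd p))"
  proof (rule lipschitz_onI)
    fix p r assume p: "p \<in> cball (0::real^2) \<rho> \<times> cball (0::real^2) M"
      and r: "r \<in> cball (0::real^2) \<rho> \<times> cball (0::real^2) M"
    have eq: "B (fst p) *\<^sub>R J (snd p) - B (fst r) *\<^sub>R J (snd r)
        = B (fst p) *\<^sub>R J (snd p - snd r) + (B (fst p) - B (fst r)) *\<^sub>R J (snd r)"
      by (simp add: J_diff[symmetric] algebra_simps)
    have "dist (B (fst p) *\<^sub>R J (snd p)) (B (fst r) *\<^sub>R J (snd r))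
        \<le> \<bar>B (fst p)\<bar> * dist (snd p) (snd r) + dist (B (fst p)) (B (fst r)) * norm (snd r)"
      unfolding dist_norm eq by (rule order_trans[OF norm_triangle_ineq]) (simp add: J_norm)
    also have "\<dots> \<le> N * dist p r + (L * dist p r) * \<bar>M\<bar>"
    proof (intro add_mono mult_mono)
      show "\<bar>B (fst p)\<bar> \<le> N" using p by (intro N) auto
      have "dist (B (fst p)) (B (fst r)) \<le> L * dist (fst p) (fst r)"
        using p r by (intro lipschitz_onD[OF L]) auto
      also have "\<dots> \<le> L * dist p r"
        using \<open>0 \<le> L\<close> by (intro mult_left_mono dist_fst_le)
      finally show "dist (B (fst p)) (B (fst r)) \<le> L * dist p r" .
    qed (use r \<open>0 < N\<close> \<open>0 \<le> L\<close> in \<open>auto intro: dist_snd_le\<close>)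
    finally show "dist (B (fst p) *\<^sub>R J (snd p)) (B (fst r) *\<^sub>R J (snd r))
        \<le> (N + L * \<bar>M\<bar>) * dist p r"
      by (simp add: algebra_simps)
  qed (use \<open>0 < N\<close> \<open>0 \<le> L\<close> in simp)
  moreover have "1-lipschitz_on (cball 0 \<rho> \<times> cball 0 M) (snd :: (real^2) \<times> (real^2) \<Rightarrow> real^2)"
    by (rule lipschitz_onI) (auto intro: dist_snd_le)
  ultimately show ?thesis
    using that lipschitz_on_Pair unfolding magnetic_field_def J_def by blast
qed

theorem proposition2p3:
  fixes B :: "real^2 \<Rightarrow> real" and q v :: "real \<Rightarrow> real^2" and T :: ereal
  assumes "local_lipschitz (UNIV :: real set) unit_disc (\<lambda>_. B)"
    and "radial_on unit_disc B"
    and "maximal_magnetic_solution B T q v"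
    and "hyp_H1 B (q 0) (v 0) \<or> hyp_H2 B (q 0) (v 0)"
  shows "T = \<infinity> \<and> (\<exists>\<eta>. 0 \<le> \<eta> \<and> \<eta> < 1 \<and> (\<forall>t\<ge>0. norm (q t) < \<eta>))"
proof -
  have sol: "magnetic_solution B T q v"
    and maxi: "\<And>T' q' v'. T < T' \<Longrightarrow> magnetic_solution B T' q' v' \<Longrightarrow> \<exists>t\<in>time_dom T. q' t \<noteq> q t"
    using assms(3) unfolding maximal_magnetic_solution_def by blast+
  have cont: "continuous_on unit_disc B"
    using local_lipschitz_continuous_on[OF assms(1)] by auto
  obtain \<rho> where \<rho>: "0 \<le> \<rho>" "\<rho> < 1" and q: "\<And>t. t \<in> time_dom T \<Longrightarrow> norm (q t) \<le> \<rho>"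
    using magnetic_solution_confined[OF assms(2) cont sol assms(4)] by blast
  have "T = \<infinity>"
  proof (rule ccontr)
    assume "T \<noteq> \<infinity>"
    moreover have "0 < T" using sol by (simp add: magnetic_solution_def)
    ultimately obtain S where T: "T = ereal S" and "0 < S" by (cases T) auto
    have dom: "time_dom (ereal R) = {0..<R}" for R by (auto simp: time_dom_def)
    \<comment> \<open>The midpoint leaves room for the position beyond \<open>\<rho>\<close> while
      keeping K's positions inside the open disc; \<open>M + 1\<close> leaves room for the velocity
      beyond the conserved speed M.\<close>
    define \<sigma> where "\<sigma> = (\<rho> + 1) / 2"
    have \<sigma>: "\<rho> < \<sigma>" "\<sigma> < 1" using \<rho> by (auto simp: \<sigma>_def)
    define M where "M = norm (v 0)"
    define K where "K = cball (0::real^2) \<sigma> \<times> cball (0::real^2) (M + 1)"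
    obtain L where L: "L-lipschitz_on K (magnetic_field B)"
      unfolding K_def by (rule magnetic_field_lipschitz[OF assms(1) \<sigma>(2)])
    obtain S' p where S': "S < S'" and pq: "\<And>t. t \<in> {0..<S} \<Longrightarrow> p t = (q t, v t)"
      and pK: "\<And>t. t \<in> {0..<S'} \<Longrightarrow> p t \<in> K"
      and p: "\<And>t. t \<in> {0..<S'} \<Longrightarrow>
        (p has_vector_derivative magnetic_field B (p t)) (at t within {0..<S'})"
    proof (rule ode_extension_lipschitz[OF L])
      show "convex K" "closed K" unfolding K_def by (auto intro: convex_Times closed_Times)
      show "closed (cball (0::real^2) \<rho> \<times> cball (0::real^2) M)" by (auto intro: closed_Times)
      show "cball (0::real^2) \<rho> \<times> cball (0::real^2) M \<subseteq> interior K"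
        using \<sigma> by (auto simp: K_def interior_Times)
      show "((\<lambda>t. (q t, v t)) has_vector_derivative magnetic_field B (q t, v t))
          (at t within {0..<S})" if "t \<in> {0..<S}" for t
        using sol that unfolding magnetic_solution_iff_phase_space T dom by blast
      show "(q t, v t) \<in> cball 0 \<rho> \<times> cball 0 M" if "t \<in> {0..<S}" for t
        using q[of t] magnetic_speed_constant[OF sol, of t] that by (auto simp: T dom M_def)
    qed (use \<open>0 < S\<close> in auto)
    have "magnetic_solution B (ereal S') (\<lambda>t. fst (p t)) (\<lambda>t. snd (p t))"
      unfolding magnetic_solution_iff_phase_space dom
      using p pK \<sigma> S' \<open>0 < S\<close> by (fastforce simp: K_def)
    then show False
      using maxi[of "ereal S'" "\<lambda>t. fst (p t)" "\<lambda>t. snd (p t)"] S' pq by (auto simp: T dom)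
  qed
  \<comment> \<open>Confinement gives only a weak inequality with \<open>\<rho>\<close>; the
    midpoint to 1 makes it strict.\<close>
  moreover have "norm (q t) < (\<rho> + 1) / 2" if "0 \<le> t" for t
    using q[of t] \<rho> that by (auto simp: time_dom_def \<open>T = \<infinity>\<close>)
  ultimately show ?thesis using \<rho> by (intro conjI exI[of _ "(\<rho> + 1) / 2"]) auto
qed

end
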